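(* Let $V$ and $W$ be vector spaces over $\mathbb{Q}$ and let $n\in\mathbb{N}$, $n\ge 1$. Suppose the mapping $f:V^n\to W$ satisfies the equation $$\sum_{q\in\{-1,1\}^n} f(2x_1+qx_2)=\sum_{k=0}^{n}2^{n-k}12^{k}f(\mathcal M_{k}^n)$$ for all $x_1,x_2\in V^n$, where $f(\mathcal M_k^n)=\sum_{s} f(x_1+sx_2)$, the sum being over all $s\in\{-1,0,1\}^n$ having exactly $k$ entries equal to $0$. Suppose also that $f$ satisfies the $3$-power condition in each variable, i.e. for every $j\in\{1,\dots,n\}$ and all $(z_1,\dots,z_n)\in V^n$, $$f(z_1,\dots,z_{j-1},2z_j,z_{j+1},\dots,z_n)=2^3 f(z_1,\dots,z_{j-1},z_j,z_{j+1},\dots,z_n).$$ Then $f$ is multi-cubic.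
   Context: For $x_i=(x_{i1},\dots,x_{in})\in V^n$ ($i\in\{1,2\}$) and $t=(t_1,\dots,t_n)\in\{-1,0,1\}^n$, write $2x_1=(2x_{11},\dots,2x_{1n})$ and $tx_2=(t_1x_{21},\dots,t_nx_{2n})$; addition in $V^n$ is componentwise. A mapping $\mathfrak C:V\to W$ is called cubic if $\mathfrak C(2x+y)+\mathfrak C(2x-y)=2\mathfrak C(x+y)+2\mathfrak C(x-y)+12\mathfrak C(x)$ for all $x,y\in V$. A mapping $f:V^n\to W$ is called multi-cubic if it is cubic in each variable, i.e. for each $j\in\{1,\dots,n\}$ and each choice of the other $n-1$ arguments, the resulting mapping of the $j$th argument is cubic. The quantity $f(\mathcal M_k^n)$ (depending on $x_1,x_2$) is the sum of $f(N_1,\dots,N_n)$ over all choices of $N_j\in\{x_{1j}+x_{2j},\,x_{1j}-x_{2j},\,x_{1j}\}$ in which exactly $k$ of the components are chosen to be $x_{1j}$. *)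

theory Defs
  imports "HOL-Analysis.Finite_Cartesian_Product"
begin

text \<open>
  Vector spaces over the rationals are types of class \<open>ab_group_add\<close> with an explicit scalar
  multiplication \<open>sV\<close>, \<open>sW\<close> satisfying the locale predicate \<open>vector_space\<close>.  The power \<open>V^n\<close> is
  \<open>'v ^ 'n\<close> with \<open>n = CARD('n) \<ge> 1\<close>.
\<close>

definition vec_mult :: "(rat \<Rightarrow> 'v \<Rightarrow> 'v) \<Rightarrow> rat ^ 'n \<Rightarrow> 'v ^ 'n \<Rightarrow> 'v ^ 'n" where
  "vec_mult sV t x = (\<chi> i. sV (t $ i) (x $ i))"

definition vec_scale :: "(rat \<Rightarrow> 'v \<Rightarrow> 'v) \<Rightarrow> rat \<Rightarrow> 'v ^ 'n \<Rightarrow> 'v ^ 'n" where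
  "vec_scale sV c x = (\<chi> i. sV c (x $ i))"

definition vec_update :: "'v ^ 'n \<Rightarrow> 'n \<Rightarrow> 'v \<Rightarrow> 'v ^ 'n" where
  "vec_update z j u = (\<chi> i. if i = j then u else z $ i)"

definition cubic ::
  "(rat \<Rightarrow> 'v \<Rightarrow> 'v) \<Rightarrow> (rat \<Rightarrow> 'w \<Rightarrow> 'w) \<Rightarrow> ('v::ab_group_add \<Rightarrow> 'w::ab_group_add) \<Rightarrow> bool" where
  "cubic sV sW C \<longleftrightarrow>
    (\<forall>x y. C (sV 2 x + y) + C (sV 2 x - y) =
           sW 2 (C (x + y)) + sW 2 (C (x - y)) + sW 12 (C x))"

definition multi_cubic ::
  "(rat \<Rightarrow> 'v \<Rightarrow> 'v) \<Rightarrow> (rat \<Rightarrow> 'w \<Rightarrow> 'w) \<Rightarrow>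
    (('v::ab_group_add) ^ 'n \<Rightarrow> 'w::ab_group_add) \<Rightarrow> bool" where
  "multi_cubic sV sW f \<longleftrightarrow> (\<forall>j z. cubic sV sW (\<lambda>u. f (vec_update z j u)))"

definition f_M ::
  "(rat \<Rightarrow> 'v \<Rightarrow> 'v) \<Rightarrow> (('v::ab_group_add) ^ 'n \<Rightarrow> 'w::ab_group_add) \<Rightarrow>
    nat \<Rightarrow> 'v ^ 'n \<Rightarrow> 'v ^ 'n \<Rightarrow> 'w" where
  "f_M sV f k x1 x2 =
    (\<Sum>s\<in>{s :: rat ^ 'n. (\<forall>i. s $ i \<in> {-1, 0, 1}) \<and> card {i. s $ i = 0} = k}.
      f (x1 + vec_mult sV s x2))"

definition three_power_condition ::
  "(rat \<Rightarrow> 'v \<Rightarrow> 'v) \<Rightarrow> (rat \<Rightarrow> 'w \<Rightarrow> 'w) \<Rightarrow> ('v ^ 'n \<Rightarrow> 'w) \<Rightarrow> bool" where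
  "three_power_condition sV sW f \<longleftrightarrow>
    (\<forall>j z. f (vec_update z j (sV 2 (z $ j))) = sW (2 ^ 3) (f z))"

end

theory Submission
  imports Defs
begin

text \<open>Fix a coordinate \<open>j\<close> and let \<open>x2\<close> vanish outside \<open>j\<close>. Every summand then depends only on
  the \<open>j\<close>-th sign, so the remaining coordinates merely contribute factors: \<open>2 ^ (n - 1)\<close> sign
  choices times \<open>8 ^ (n - 1)\<close> from the 3-power condition on the left, and
  \<open>(2 + 12 + 2) ^ (n - 1)\<close> on the right. These agree and cancel.\<close>

text \<open>Prescribing the entry at \<open>j\<close> leaves a product of index sets,
  \<open>{t}\<close> at \<open>j\<close> and \<open>T\<close> elsewhere, so distributivity turns the
  sum of products into a product of sums, one for each coordinate.\<close>

lemma sum_prod_vec_fix: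
  fixes c :: "'a \<Rightarrow> 'b::comm_semiring_1" and j :: "'n::finite"
  assumes "finite T" "t \<in> T"
  shows "(\<Sum>s\<in>{s :: 'a ^ 'n. (\<forall>i. s $ i \<in> T) \<and> s $ j = t}. \<Prod>i\<in>UNIV. c (s $ i))
         = c t * sum c T ^ (CARD('n) - 1)"
proof -
  define B where "B i = (if i = j then {t} else T)" for i :: 'n
  have "(\<Sum>s\<in>{s :: 'a ^ 'n. (\<forall>i. s $ i \<in> T) \<and> s $ j = t}. \<Prod>i\<in>UNIV. c (s $ i))
        = (\<Sum>g\<in>PiE UNIV B. \<Prod>i\<in>UNIV. c (g i))"
    by (rule sum.reindex_bij_witness[of _ vec_lambda vec_nth])
      (use assms in \<open>auto simp: B_def PiE_def Pi_def vec_lambda_inverse split: if_splits\<close>)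
  also have "\<dots> = (\<Prod>i\<in>UNIV. sum c (B i))"
    using assms by (subst prod_sum_PiE) (auto simp: B_def)
  also have "\<dots> = sum c (B j) * (\<Prod>i\<in>UNIV - {j}. sum c (B i))"
    by (rule prod.remove) auto
  also have "(\<Prod>i\<in>UNIV - {j}. sum c (B i)) = (\<Prod>i\<in>UNIV - {j}. sum c T)"
    by (rule prod.cong) (auto simp: B_def)
  finally show ?thesis
    by (simp add: B_def)
qed

lemma finite_vec_set:
  assumes "finite T"
  shows "finite {s :: 'a ^ 'n::finite. \<forall>i. s $ i \<in> T}"
proof (rule finite_imageD)
  have "vec_nth ` {s :: 'a ^ 'n. \<forall>i. s $ i \<in> T} \<subseteq> PiE UNIV (\<lambda>_. T)"
    by auto
  then show "finite (vec_nth ` {s :: 'a ^ 'n. \<forall>i. s $ i \<in> T})"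
    by (rule finite_subset) (simp add: assms finite_PiE)
qed (simp add: inj_on_def vec_nth_inject)

text \<open>Group the vectors by their entry \<open>t\<close> at \<open>j\<close>: within a group
  \<open>G t\<close> is a common factor, and \<open>sum_prod_vec_fix\<close> evaluates the total
  weight. Both sides of the functional equation collapse to one variable in this way.\<close>

lemma (in vector_space) sum_vec_scale_single:
  fixes c :: "'d \<Rightarrow> 'a" and j :: "'n::finite"
  assumes "finite T"
  shows "(\<Sum>s\<in>{s :: 'd ^ 'n. \<forall>i. s $ i \<in> T}. scale (\<Prod>i\<in>UNIV. c (s $ i)) (G (s $ j)))
         = scale (sum c T ^ (CARD('n) - 1)) (\<Sum>t\<in>T. scale (c t) (G t))"
proof -
  let ?S = "{s :: 'd ^ 'n. \<forall>i. s $ i \<in> T}"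
  have "(\<Sum>s\<in>?S. scale (\<Prod>i\<in>UNIV. c (s $ i)) (G (s $ j)))
        = (\<Sum>t\<in>T. \<Sum>s\<in>{s \<in> ?S. s $ j = t}. scale (\<Prod>i\<in>UNIV. c (s $ i)) (G (s $ j)))"
    by (rule sum.group[symmetric]) (use assms finite_vec_set in auto)
  also have "\<dots> = (\<Sum>t\<in>T. scale (\<Sum>s\<in>{s \<in> ?S. s $ j = t}. \<Prod>i\<in>UNIV. c (s $ i)) (G t))"
    by (simp add: scale_sum_left)
  also have "\<dots> = (\<Sum>t\<in>T. scale (c t * sum c T ^ (CARD('n) - 1)) (G t))"
    by (rule sum.cong) (simp_all add: sum_prod_vec_fix assms)
  finally show ?thesis
    by (simp add: scale_sum_right mult.commute)
qed

text \<open>Induction on \<open>A\<close>: each new index costs one use of the condition, hence one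
  factor \<open>2 ^ 3 = 8\<close>.\<close>

lemma three_power_condition_set:
  fixes f :: "'v::ab_group_add ^ 'n::finite \<Rightarrow> 'w::ab_group_add"
  assumes "vector_space sW" "three_power_condition sV sW f"
  shows "f (\<chi> i. if i \<in> A then sV 2 (z $ i) else z $ i) = sW (8 ^ card A) (f z)"
proof -
  interpret W: vector_space sW by fact
  have "finite A" by simp
  then show ?thesis
  proof (induction A)
    case empty
    then show ?case by simp
  next
    case (insert j A)
    define w where "w = (\<chi> i. if i \<in> A then sV 2 (z $ i) else z $ i)"
    \<comment> \<open>Since \<open>j\<close> lies outside \<open>A\<close>, \<open>w $ j\<close> is
      still \<open>z $ j\<close>, so this coordinate is doubled only once.\<close>
    have "(\<chi> i. if i \<in> insert j A then sV 2 (z $ i) else z $ i) = vec_update w j (sV 2 (w $ j))"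
      using insert.hyps by (auto simp: vec_eq_iff vec_update_def w_def)
    also have "f \<dots> = sW 8 (f w)"
      using assms(2) by (simp add: three_power_condition_def)
    finally show ?case
      using insert by (simp add: w_def)
  qed
qed

text \<open>The weight \<open>a ^ (n - k) * b ^ k\<close> is multiplicative over coordinates: each
  zero entry contributes \<open>b\<close>, each nonzero entry \<open>a\<close>. The layers for the
  different \<open>k\<close> thus merge into one sum of the shape that
  \<open>sum_vec_scale_single\<close> handles.\<close>

lemma sum_f_M_eq:
  fixes f :: "'v::ab_group_add ^ 'n::finite \<Rightarrow> 'w::ab_group_add"
  assumes "vector_space sW"
  shows "(\<Sum>k=0..CARD('n). sW (a ^ (CARD('n) - k) * b ^ k) (f_M sV f k x1 x2))
    = (\<Sum>s\<in>{s :: rat ^ 'n. \<forall>i. s $ i \<in> {-1, 0, 1}}.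
        sW (\<Prod>i\<in>UNIV. if s $ i = 0 then b else a) (f (x1 + vec_mult sV s x2)))"
proof -
  interpret W: vector_space sW by fact
  let ?S = "{s :: rat ^ 'n. \<forall>i. s $ i \<in> {-1, 0, 1}}"
  have weight: "(\<Prod>i\<in>UNIV. if s $ i = 0 then b else a)
      = a ^ (CARD('n) - card {i. s $ i = 0}) * b ^ card {i. s $ i = 0}" for s :: "rat ^ 'n"
    using card_Diff_subset[of "{i. s $ i = 0}" UNIV]
    by (simp add: prod.If_cases Compl_eq_Diff_UNIV mult.commute)
  have "(\<Sum>s\<in>?S. sW (\<Prod>i\<in>UNIV. if s $ i = 0 then b else a) (f (x1 + vec_mult sV s x2)))
      = (\<Sum>k=0..CARD('n). \<Sum>s\<in>{s \<in> ?S. card {i. s $ i = 0} = k}.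
          sW (\<Prod>i\<in>UNIV. if s $ i = 0 then b else a) (f (x1 + vec_mult sV s x2)))"
  proof (rule sum.group[symmetric])
    show "finite ?S"
      by (rule finite_vec_set) simp
    show "(\<lambda>s. card {i. s $ i = 0}) ` ?S \<subseteq> {0..CARD('n)}"
      by (simp add: image_subset_iff card_mono)
  qed simp
  also have "\<dots> = (\<Sum>k=0..CARD('n). sW (a ^ (CARD('n) - k) * b ^ k) (f_M sV f k x1 x2))"
    by (simp add: weight f_M_def W.scale_sum_right)
  finally show ?thesis ..
qed

theorem proposition2p3:
  fixes sV :: "rat \<Rightarrow> 'v::ab_group_add \<Rightarrow> 'v"
    and sW :: "rat \<Rightarrow> 'w::ab_group_add \<Rightarrow> 'w"
    and f :: "'v ^ ('n::finite) \<Rightarrow> 'w"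
  assumes "vector_space sV"
    and "vector_space sW"
    and "\<forall>x1 x2.
      (\<Sum>q\<in>{q :: rat ^ 'n. \<forall>i. q $ i \<in> {-1, 1}}. f (vec_scale sV 2 x1 + vec_mult sV q x2)) =
      (\<Sum>k=0..CARD('n). sW (2 ^ (CARD('n) - k) * 12 ^ k) (f_M sV f k x1 x2))"
    and "three_power_condition sV sW f"
  shows "multi_cubic sV sW f"
  unfolding multi_cubic_def cubic_def
proof (intro allI)
  interpret V: vector_space sV by fact
  interpret W: vector_space sW by fact
  fix j :: 'n and z :: "'v ^ 'n" and x y :: 'v
  define g where "g u = f (vec_update z j u)" for u
  define x1 where "x1 = vec_update z j x"
  define x2 where "x2 = vec_update 0 j y"
  define m where "m = CARD('n) - 1"
  \<comment> \<open>The \<open>m\<close> coordinates other than \<open>j\<close> hold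
    \<open>2 z_i\<close>, which gives \<open>8 ^ m\<close>. The empty-looking product of ones
    supplies the constant weight \<open>c = 1\<close> for
    \<open>sum_vec_scale_single\<close>.\<close>
  have L: "f (vec_scale sV 2 x1 + vec_mult sV q x2)
      = sW (\<Prod>i\<in>UNIV. (\<lambda>_. 1) (q $ i)) (sW (8 ^ m) (g (sV 2 x + sV (q $ j) y)))" for q
  proof -
    have "vec_scale sV 2 x1 + vec_mult sV q x2 =
        (\<chi> i. if i \<in> UNIV - {j} then sV 2 (vec_update z j (sV 2 x + sV (q $ j) y) $ i)
              else vec_update z j (sV 2 x + sV (q $ j) y) $ i)"
      by (auto simp: vec_eq_iff vec_update_def vec_scale_def vec_mult_def x1_def x2_def)
    then show ?thesis
      by (simp only: three_power_condition_set[OF assms(2,4)]) (simp add: g_def m_def)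
  qed
  have R: "f (x1 + vec_mult sV s x2) = g (x + sV (s $ j) y)" for s
    unfolding g_def
    by (rule arg_cong[of _ _ f]) (auto simp: vec_eq_iff vec_update_def vec_mult_def x1_def x2_def)
  have "(\<Sum>q\<in>{q :: rat ^ 'n. \<forall>i. q $ i \<in> {-1, 1}}. f (vec_scale sV 2 x1 + vec_mult sV q x2))
      = sW (2 ^ m) (\<Sum>t\<in>{-1, 1}. sW 1 (sW (8 ^ m) (g (sV 2 x + sV t y))))"
    unfolding L by (subst W.sum_vec_scale_single) (auto simp: m_def)
  \<comment> \<open>The free signs give \<open>2 ^ m\<close>, and
    \<open>2 ^ m * 8 ^ m = 16 ^ m\<close>.\<close>
  also have "\<dots> = sW (16 ^ m) (g (sV 2 x + y) + g (sV 2 x - y))"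
    by (simp add: W.scale_right_distrib power_mult_distrib[symmetric] add.commute)
  finally have lhs: "(\<Sum>q\<in>{q :: rat ^ 'n. \<forall>i. q $ i \<in> {-1, 1}}.
      f (vec_scale sV 2 x1 + vec_mult sV q x2)) = sW (16 ^ m) (g (sV 2 x + y) + g (sV 2 x - y))" .
  have "(\<Sum>k=0..CARD('n). sW (2 ^ (CARD('n) - k) * 12 ^ k) (f_M sV f k x1 x2))
      = sW (16 ^ m) (\<Sum>t\<in>{-1, 0, 1}. sW (if t = 0 then 12 else 2) (g (x + sV t y)))"
    \<comment> \<open>Here each free coordinate contributes \<open>2 + 12 + 2 = 16\<close>, matching
      the factor on the other side.\<close>
    unfolding sum_f_M_eq[OF assms(2)] R
    by (subst W.sum_vec_scale_single[where c = "\<lambda>t. if t = 0 then 12 else 2"]) (auto simp: m_def)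
  also have "\<dots> = sW (16 ^ m) (sW 2 (g (x + y)) + sW 2 (g (x - y)) + sW 12 (g x))"
    by (simp add: algebra_simps)
  finally have "sW (16 ^ m) (g (sV 2 x + y) + g (sV 2 x - y))
      = sW (16 ^ m) (sW 2 (g (x + y)) + sW 2 (g (x - y)) + sW 12 (g x))"
    using assms(3) lhs by metis
  \<comment> \<open>The rational \<open>16 ^ m\<close> is nonzero, so it cancels.\<close>
  then show "f (vec_update z j (sV 2 x + y)) + f (vec_update z j (sV 2 x - y)) =
      sW 2 (f (vec_update z j (x + y))) + sW 2 (f (vec_update z j (x - y)))
      + sW 12 (f (vec_update z j x))"
    by (simp add: g_def)
qed

end
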